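(* Let $G=\mathrm{PGL}(n,\mathbb{C})$ and let $K$ be a maximal diagonalizable subgroup of $G$. If $K=\mathtt{P}_{l_1}\times\cdots\times\mathtt{P}_{l_k}$ with $n=l_1\cdots l_k$ and each $l_i$ dividing $l_{i-1}$, then the pairing $\langle\cdot,\cdot\rangle$ is nonsingular on $K$. Thus $(K,\langle\cdot,\cdot\rangle)$ is a nonsingular symplectic abelian group isometric to $\mathbb{H}_{l_1}\oplus\cdots\oplus\mathbb{H}_{l_k}$.
   Context: Let $\omega_l=e^{2\pi i/l}$, $Q_l=\mathrm{diag}(1,\omega_l,\dots,\omega_l^{l-1})$, and let $P_l$ be the $l\times l$ permutation matrix with entries $1$ in positions $(i,i+1)$ for $1\le i\le l-1$ and in position $(l,1)$, and $0$ elsewhere, so $P_lQ_l=\omega_lQ_lP_l$. $\mathtt{P}_l\subset\mathrm{PGL}(l,\mathbb{C})$ is the image of the group generated by $P_l,Q_l$, i.e. $\mathtt{P}_l=\{\mathrm{Ad}_{P_l}^i\mathrm{Ad}_{Q_l}^j\}\cong\mathbb{Z}_l\times\mathbb{Z}_l$. The product $\mathtt{P}_{l_1}\times\cdots\times\mathtt{P}_{l_k}$ is identified with its image in $\mathrm{PGL}(n,\mathbb{C})$ under the embedding $\mathrm{PGL}(l_1,\mathbb{C})\times\cdots\times\mathrm{PGL}(l_k,\mathbb{C})\to\mathrm{PGL}(n,\mathbb{C})$, $(\mathrm{Ad}_{A_1},\dots,\mathrm{Ad}_{A_k})\mapsto\mathrm{Ad}_{A_1\otimes\cdots\otimes A_k}$,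 coming from $M(l_1,\mathbb{C})\otimes\cdots\otimes M(l_k,\mathbb{C})\cong M(n,\mathbb{C})$. A subgroup of $\mathrm{PGL}(n,\mathbb{C})$ is diagonalizable if it is abelian and consists of semisimple elements; maximal means maximal under inclusion among such subgroups. The pairing $\langle\cdot,\cdot\rangle:K\times K\to\mathbb{C}^\times$ is defined by $\tilde\sigma\tilde\tau\tilde\sigma^{-1}\tilde\tau^{-1}=\langle\sigma,\tau\rangle I_n$ for preimages $\tilde\sigma,\tilde\tau\in\mathrm{GL}(n,\mathbb{C})$ of $\sigma,\tau\in K$. A symplectic abelian group is an abelian group $H$ with a pairing into $\mathbb{C}^\times$ that is a homomorphism in each variable and satisfies $\langle a,a\rangle=1$ and $\langle a,b\rangle=\langle b,a\rangle^{-1}$; it (or its pairing) is nonsingular if $\langle a,b\rangle=1$ for all $b$ implies $a$ is the identity. Isometric means isomorphic via a group isomorphism preserving the pairings. $\mathbb{H}_l=\mathbb{Z}_l\times\mathbb{Z}_l$ with pairing $\langle(i,j),(k,m)\rangle=\omega_l^{im-jk}$; direct sums are orthogonal direct sums (elements of different summands pair to $1$). *)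

theory Defs
  imports
    Complex_Main
    "HOL-Algebra.Generated_Groups"
    "HOL-Algebra.Elementary_Groups"
    "HOL-Algebra.Product_Groups"
    "Jordan_Normal_Form.Matrix"
begin

section \<open>The groups \<open>GL(n, \<complex>)\<close> and \<open>PGL(n, \<complex>)\<close>\<close>

definition GL :: "nat \<Rightarrow> complex mat monoid" where
  "GL n = units_of (ring_mat TYPE(complex) n ())"

definition scalar_mats :: "nat \<Rightarrow> complex mat set" where
  "scalar_mats n = {c \<cdot>\<^sub>m 1\<^sub>m n | c. c \<noteq> 0}"

text \<open>
  Elements of \<open>PGL n\<close> are cosets, i.e. sets of matrices: the preimages in \<open>GL n\<close> of
  \<open>\<sigma> \<in> carrier (PGL n)\<close> are exactly the members of \<open>\<sigma>\<close>. The coset \<open>Ad n A\<close> of \<open>A\<close>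
  plays the role of the inner automorphism \<open>X \<mapsto> A X A\<inverse>\<close> of \<open>M(n, \<complex>)\<close>, which
  determines \<open>A\<close> exactly up to a nonzero scalar.
\<close>

definition PGL :: "nat \<Rightarrow> complex mat set monoid" where
  "PGL n = GL n Mod scalar_mats n"

definition Ad :: "nat \<Rightarrow> complex mat \<Rightarrow> complex mat set" where
  "Ad n A = scalar_mats n #>\<^bsub>GL n\<^esub> A"

section \<open>Maximal diagonalizable subgroups\<close>

text \<open>
  The semisimple elements of \<open>PGL n\<close> are the images of the semisimple, i.e.
  diagonalizable, elements of \<open>GL n\<close>; whether a preimage is diagonalizable does not
  depend on its choice, as preimages differ by nonzero scalars.
\<close>

definition semisimple :: "nat \<Rightarrow> complex mat set \<Rightarrow> bool" where
  "semisimple n \<sigma> \<longleftrightarrow>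
     (\<exists>A \<in> carrier (GL n). \<sigma> = Ad n A \<and> (\<exists>D. diagonal_mat D \<and> similar_mat A D))"

definition diagonalizable_subgroup :: "nat \<Rightarrow> complex mat set set \<Rightarrow> bool" where
  "diagonalizable_subgroup n K \<longleftrightarrow>
     subgroup K (PGL n) \<and> comm_group ((PGL n)\<lparr>carrier := K\<rparr>) \<and> (\<forall>\<sigma>\<in>K. semisimple n \<sigma>)"

definition maximal_diagonalizable_subgroup :: "nat \<Rightarrow> complex mat set set \<Rightarrow> bool" where
  "maximal_diagonalizable_subgroup n K \<longleftrightarrow>
     diagonalizable_subgroup n K \<and>
     (\<forall>K'. diagonalizable_subgroup n K' \<and> K \<subseteq> K' \<longrightarrow> K' = K)"

section \<open>Pauli groups and their products\<close>

definition root_of_unity :: "nat \<Rightarrow> complex" where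
  "root_of_unity l = exp (2 * of_real pi * \<i> / of_nat l)"

text \<open>Matrix indices start at \<open>0\<close>.\<close>

definition Q_mat :: "nat \<Rightarrow> complex mat" where
  "Q_mat l = mat l l (\<lambda>(i, j). if i = j then root_of_unity l ^ i else 0)"

definition P_mat :: "nat \<Rightarrow> complex mat" where
  "P_mat l = mat l l (\<lambda>(i, j). if j = (i + 1) mod l then 1 else 0)"

definition Pauli :: "nat \<Rightarrow> complex mat set set" where
  "Pauli l = Ad l ` generate (GL l) {P_mat l, Q_mat l}"

text \<open>
  The Kronecker product realizes \<open>M(k, \<complex>) \<otimes> M(l, \<complex>) \<cong> M(k l, \<complex>)\<close>, the pair
  \<open>(a, b)\<close> of row (or column) indices being sent to \<open>a * l + b\<close>.
\<close>

definition kronecker :: "complex mat \<Rightarrow> complex mat \<Rightarrow> complex mat" where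
  "kronecker A B = mat (dim_row A * dim_row B) (dim_col A * dim_col B)
     (\<lambda>(i, j). A $$ (i div dim_row B, j div dim_col B) * B $$ (i mod dim_row B, j mod dim_col B))"

definition kronecker_list :: "complex mat list \<Rightarrow> complex mat" where
  "kronecker_list As = foldr kronecker As (1\<^sub>m 1)"

text \<open>
  The image of \<open>Pauli l\<^sub>1 \<times> \<dots> \<times> Pauli l\<^sub>k\<close> under the embedding
  \<open>(Ad A\<^sub>1, \<dots>, Ad A\<^sub>k) \<mapsto> Ad (A\<^sub>1 \<otimes> \<dots> \<otimes> A\<^sub>k)\<close>. Here \<open>A\<^sub>1, \<dots>, A\<^sub>k\<close> range over all
  preimages of elements of the factors, so that no representatives have to be chosen.
\<close>

definition Pauli_product :: "nat list \<Rightarrow> complex mat set set" where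
  "Pauli_product ls =
     {Ad (prod_list ls) (kronecker_list As) | As.
        list_all2 (\<lambda>A l. A \<in> carrier (GL l) \<and> Ad l A \<in> Pauli l) As ls}"

section \<open>The commutator pairing\<close>

text \<open>
  If \<open>\<sigma>\<close> and \<open>\<tau>\<close> are commuting elements of \<open>PGL n\<close> with \<open>n \<ge> 1\<close>, there is exactly
  one such scalar \<open>c\<close>, and it is nonzero.
\<close>

definition pairing :: "nat \<Rightarrow> complex mat set \<Rightarrow> complex mat set \<Rightarrow> complex" where
  "pairing n \<sigma> \<tau> =
     (THE c. \<forall>A\<in>\<sigma>. \<forall>B\<in>\<tau>.
        A \<otimes>\<^bsub>GL n\<^esub> B \<otimes>\<^bsub>GL n\<^esub> inv\<^bsub>GL n\<^esub> A \<otimes>\<^bsub>GL n\<^esub> inv\<^bsub>GL n\<^esub> B = c \<cdot>\<^sub>m 1\<^sub>m n)"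

section \<open>Symplectic abelian groups\<close>

definition symplectic_abelian_group :: "'a monoid \<Rightarrow> ('a \<Rightarrow> 'a \<Rightarrow> complex) \<Rightarrow> bool" where
  "symplectic_abelian_group H p \<longleftrightarrow>
     comm_group H \<and>
     (\<forall>a\<in>carrier H. \<forall>b\<in>carrier H. p a b \<noteq> 0) \<and>
     (\<forall>a\<in>carrier H. \<forall>b\<in>carrier H. \<forall>c\<in>carrier H. p (a \<otimes>\<^bsub>H\<^esub> b) c = p a c * p b c) \<and>
     (\<forall>a\<in>carrier H. \<forall>b\<in>carrier H. \<forall>c\<in>carrier H. p a (b \<otimes>\<^bsub>H\<^esub> c) = p a b * p a c) \<and>
     (\<forall>a\<in>carrier H. p a a = 1) \<and>
     (\<forall>a\<in>carrier H. \<forall>b\<in>carrier H. p a b = inverse (p b a))"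

definition nonsingular_pairing :: "'a monoid \<Rightarrow> ('a \<Rightarrow> 'a \<Rightarrow> complex) \<Rightarrow> bool" where
  "nonsingular_pairing H p \<longleftrightarrow>
     (\<forall>a\<in>carrier H. (\<forall>b\<in>carrier H. p a b = 1) \<longrightarrow> a = \<one>\<^bsub>H\<^esub>)"

definition isometric ::
  "'a monoid \<Rightarrow> ('a \<Rightarrow> 'a \<Rightarrow> complex) \<Rightarrow> 'b monoid \<Rightarrow> ('b \<Rightarrow> 'b \<Rightarrow> complex) \<Rightarrow> bool" where
  "isometric H p H' p' \<longleftrightarrow>
     (\<exists>\<phi> \<in> iso H H'. \<forall>a\<in>carrier H. \<forall>b\<in>carrier H. p' (\<phi> a) (\<phi> b) = p a b)"

definition hyperbolic_group :: "nat \<Rightarrow> (int \<times> int) monoid" where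
  "hyperbolic_group l = integer_mod_group l \<times>\<times> integer_mod_group l"

definition hyperbolic_pairing :: "nat \<Rightarrow> int \<times> int \<Rightarrow> int \<times> int \<Rightarrow> complex" where
  "hyperbolic_pairing l = (\<lambda>(i, j) (k, m). root_of_unity l powi (i * m - j * k))"

text \<open>
  For finitely many summands the direct sum is the product group, and the pairing for
  which different summands are orthogonal is the product of the componentwise pairings.
\<close>

definition hyperbolic_sum_group :: "nat list \<Rightarrow> (nat \<Rightarrow> int \<times> int) monoid" where
  "hyperbolic_sum_group ls = product_group {..<length ls} (\<lambda>i. hyperbolic_group (ls ! i))"

definition hyperbolic_sum_pairing ::
  "nat list \<Rightarrow> (nat \<Rightarrow> int \<times> int) \<Rightarrow> (nat \<Rightarrow> int \<times> int) \<Rightarrow> complex" where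
  "hyperbolic_sum_pairing ls x y = (\<Prod>i<length ls. hyperbolic_pairing (ls ! i) (x i) (y i))"

end

theory Submission
  imports Defs "HOL-Library.Product_Plus"
begin

text \<open>
  Up to scalars, \<open>P_mat l\<close> and \<open>Q_mat l\<close> generate the Weyl matrices \<open>P\<^sup>i Q\<^sup>j\<close>, and these
  multiply like the vectors \<open>(i, j)\<close> up to a root of unity. Hence the Kronecker products
  \<open>weyl_tensor ls x\<close> of Weyl matrices, with \<open>x\<close> a family of integer vectors, form a
  projective representation of \<open>(\<int> \<times> \<int>)\<^sup>k\<close>, where \<open>k\<close> is the length of \<open>ls\<close>
  (\<open>weyl_tensor_mult\<close>). Its classes in \<open>PGL\<close> are exactly the elements of the product of
  Pauli groups (\<open>Pauli_product_eq\<close>), so \<open>x \<mapsto> weyl_class ls x\<close> is a surjective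
  homomorphism from \<open>(\<int> \<times> \<int>)\<^sup>k\<close> onto that group.

  Interchanging two factors changes the cocycle of the representation by the hyperbolic
  pairing of their indices; therefore the homomorphism carries the hyperbolic pairing to
  the commutator pairing (\<open>pairing_weyl_class\<close>), and the symplectic identities are those
  of an explicit product of powers of roots of unity. Since \<open>root_of_unity l\<close> is
  primitive, an integer family orthogonal to every other one vanishes modulo the entries of
  \<open>ls\<close> (\<open>hyperbolic_sum_pairing_nonsingular\<close>). This gives nonsingularity. It also
  gives injectivity on the families of residues, as an element of the kernel is orthogonal
  to everything; so the homomorphism restricts to an isomorphism from the hyperbolic sum,
  and its inverse is the isometry.

  Indices are integers throughout, and are reduced only where the hyperbolic group
  enters, so that no sum of indices needs a case distinction.
\<close>

section \<open>Roots of unity\<close>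

lemma root_of_unity_eq_cis: "root_of_unity l = cis (2 * pi / of_nat l)"
  by (simp add: root_of_unity_def cis_conv_exp mult_ac)

lemma root_of_unity_nonzero [simp]: "root_of_unity l \<noteq> 0"
  by (simp add: root_of_unity_def)

lemma root_of_unity_powi_eq_1_iff:
  assumes "l > 0"
  shows "root_of_unity l powi k = 1 \<longleftrightarrow> int l dvd k"
proof
  assume "root_of_unity l powi k = 1"
  hence "cos (of_int k * (2 * pi / of_nat l)) = 1"
    by (metis cis.sel(1) cis_power_int one_complex.sel(1) root_of_unity_eq_cis)
  then obtain x :: int where "of_int k * (2 * pi / of_nat l) = of_int x * 2 * pi"
    by (auto simp: cos_one_2pi_int)
  hence "real_of_int k = real_of_int (int l * x)"
    using assms by (simp add: field_simps)
  hence "k = int l * x" by (simp only: of_int_eq_iff)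
  thus "int l dvd k" by simp
next
  assume "int l dvd k"
  then obtain x where "k = int l * x" ..
  hence "root_of_unity l powi k = cis (2 * pi * of_int x)"
    using assms by (simp add: root_of_unity_eq_cis cis_power_int field_simps)
  thus "root_of_unity l powi k = 1" by simp
qed

lemma root_of_unity_powi_cong:
  assumes "l > 0" "i mod int l = j mod int l"
  shows "root_of_unity l powi i = root_of_unity l powi j"
proof -
  have "root_of_unity l powi (i - j) = 1"
    using assms by (simp add: root_of_unity_powi_eq_1_iff mod_eq_dvd_iff)
  thus ?thesis by (simp add: power_int_diff)
qed

section \<open>Scalar multiples of matrices\<close>

lemma smult_smult_mat: "s \<cdot>\<^sub>m (t \<cdot>\<^sub>m A) = (s * t) \<cdot>\<^sub>m (A :: 'a :: semigroup_mult mat)"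
  by (rule eq_matI) (simp_all add: mult.assoc)

lemma one_smult_mat: "1 \<cdot>\<^sub>m A = (A :: 'a :: monoid_mult mat)"
  by (rule eq_matI) simp_all

lemma smult_one_mult: "A \<in> carrier_mat n n \<Longrightarrow> (c \<cdot>\<^sub>m 1\<^sub>m n) * A = c \<cdot>\<^sub>m (A :: 'a :: comm_semiring_1 mat)"
  by (simp add: mult_smult_assoc_mat[of _ n n _ n])

lemma mult_smult_one: "A \<in> carrier_mat n n \<Longrightarrow> A * (c \<cdot>\<^sub>m 1\<^sub>m n) = c \<cdot>\<^sub>m (A :: 'a :: comm_semiring_1 mat)"
  by (simp add: mult_smult_distrib[of _ n n _ n])

section \<open>Weyl matrices\<close>

text \<open>
  This is \<open>P\<^sup>i Q\<^sup>j\<close> for \<open>a = (i, j)\<close>, given by its entries: \<open>P\<^sup>i\<close> has its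
  nonzero entries in the positions \<open>(r, r + i)\<close> modulo \<open>l\<close>, and \<open>Q\<^sup>j\<close> on the
  right scales column \<open>c\<close>. In this form negative exponents need no inverse matrices, and
  periodicity in \<open>i\<close> and \<open>j\<close> is visible.
\<close>

definition weyl :: "nat \<Rightarrow> int \<times> int \<Rightarrow> complex mat" where
  "weyl l a = mat l l (\<lambda>(r, c).
     if int c = (int r + fst a) mod int l then root_of_unity l powi (int c * snd a) else 0)"

lemma weyl_carrier [simp]: "weyl l a \<in> carrier_mat l l"
  by (simp add: weyl_def)

lemma weyl_cong:
  assumes "l > 0" "fst a mod int l = fst b mod int l" "snd a mod int l = snd b mod int l"
  shows "weyl l a = weyl l b"
proof -
  have "(int r + fst a) mod int l = (int r + fst b) mod int l" for r
    using assms(2) by (intro mod_add_cong) auto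
  moreover have "root_of_unity l powi (int c * snd a) = root_of_unity l powi (int c * snd b)" for c
    using assms by (intro root_of_unity_powi_cong mod_mult_cong) auto
  ultimately show ?thesis unfolding weyl_def by (simp only:)
qed

lemma weyl_zero: "weyl l 0 = 1\<^sub>m l"
  by (rule eq_matI) (auto simp: weyl_def)

lemma weyl_P: "weyl l (1, 0) = P_mat l"
  by (rule eq_matI) (auto simp: weyl_def P_mat_def add.commute simp flip: of_nat_Suc of_nat_mod)

lemma weyl_Q: "weyl l (0, 1) = Q_mat l"
  by (rule eq_matI) (auto simp: weyl_def Q_mat_def)

text \<open>
  Let \<open>a = (i, j)\<close> and \<open>b = (k, m)\<close>. Moving \<open>Q\<^sup>j\<close> to the right past \<open>P\<^sup>k\<close> costs the factor
  \<open>\<omega>\<^sup>-\<^sup>j\<^sup>k\<close>, because \<open>P Q = \<omega> Q P\<close>. On entries: the only index through which row \<open>r\<close>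
  reaches a column \<open>c\<close> is \<open>s\<^sub>0 = r + i\<close>, which is \<open>c - k\<close> modulo \<open>l\<close>, so that
  \<open>\<omega>\<close> gets the exponent \<open>(c - k) j + c m\<close>.
\<close>

lemma weyl_mult:
  assumes "l > 0"
  shows "weyl l a * weyl l b = root_of_unity l powi (- (snd a * fst b)) \<cdot>\<^sub>m weyl l (a + b)"
proof (rule eq_matI)
  fix r c
  assume "r < dim_row (root_of_unity l powi (- (snd a * fst b)) \<cdot>\<^sub>m weyl l (a + b))"
    and "c < dim_col (root_of_unity l powi (- (snd a * fst b)) \<cdot>\<^sub>m weyl l (a + b))"
  hence rc: "r < l" "c < l" by (simp_all add: weyl_def)
  let ?w = "root_of_unity l"
  define s0 where "s0 = nat ((int r + fst a) mod int l)"
  have s0: "int s0 = (int r + fst a) mod int l" "s0 < l"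
    using assms by (simp_all add: s0_def nat_less_iff)
  have step: "(int s0 + fst b) mod int l = (int r + fst (a + b)) mod int l"
    by (simp add: s0(1) mod_simps add.assoc)
  have "(weyl l a * weyl l b) $$ (r, c) = (\<Sum>s<l. weyl l a $$ (r, s) * weyl l b $$ (s, c))"
    using rc by (simp add: scalar_prod_def weyl_def lessThan_atLeast0)
  also have "\<dots> = (\<Sum>s<l. if s = s0 then weyl l a $$ (r, s) * weyl l b $$ (s, c) else 0)"
    using rc by (intro sum.cong) (auto simp: weyl_def simp flip: s0(1))
  also have "\<dots> = weyl l a $$ (r, s0) * weyl l b $$ (s0, c)"
    using s0(2) by simp
  also have "\<dots> = ?w powi (- (snd a * fst b)) * weyl l (a + b) $$ (r, c)"
  proof (cases "int c = (int s0 + fst b) mod int l")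
    case True
    have "?w powi (int s0 * snd a) * ?w powi (int c * snd b)
        = ?w powi (int s0 * snd a + int c * snd b)"
      by (simp add: power_int_add)
    also have "\<dots> = ?w powi (- (snd a * fst b) + int c * (snd a + snd b))"
    proof (rule root_of_unity_powi_cong[OF assms])
      have "int s0 mod int l = (int c - fst b) mod int l"
        by (simp add: True mod_simps)
      hence "(int s0 * snd a + int c * snd b) mod int l
          = ((int c - fst b) * snd a + int c * snd b) mod int l"
        by (intro mod_add_cong mod_mult_cong) auto
      thus "(int s0 * snd a + int c * snd b) mod int l
          = (- (snd a * fst b) + int c * (snd a + snd b)) mod int l"
        by (simp add: algebra_simps)
    qed
    finally show ?thesis
      using rc s0 True step by (simp add: weyl_def flip: power_int_add)
  qed (use rc s0 step in \<open>simp add: weyl_def\<close>)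
  finally show "(weyl l a * weyl l b) $$ (r, c)
      = (?w powi (- (snd a * fst b)) \<cdot>\<^sub>m weyl l (a + b)) $$ (r, c)"
    using rc by (simp add: weyl_def)
qed (simp_all add: weyl_def)

section \<open>Kronecker products\<close>

lemma less_mult_imp_mod_less: "(i :: nat) < m * l \<Longrightarrow> i mod l < l"
  by (cases l) auto

lemma kronecker_carrier:
  assumes "A \<in> carrier_mat a b" "B \<in> carrier_mat c d"
  shows "kronecker A B \<in> carrier_mat (a * c) (b * d)"
  using assms by (auto simp: kronecker_def)

text \<open>
  The mixed product property: a summation index below \<open>b * d\<close> is a pair of its quotient
  and its remainder modulo \<open>d\<close>, so the sum over it factors into two.
\<close>

lemma kronecker_mult:
  assumes A: "A \<in> carrier_mat a b" and B: "B \<in> carrier_mat c d"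
    and C: "C \<in> carrier_mat b e" and D: "D \<in> carrier_mat d f"
  shows "kronecker A B * kronecker C D = kronecker (A * C) (B * D)"
proof (rule eq_matI)
  have dims: "dim_row A = a" "dim_col A = b" "dim_row B = c" "dim_col B = d"
    "dim_row C = b" "dim_col C = e" "dim_row D = d" "dim_col D = f"
    using assms by auto
  fix i j
  assume "i < dim_row (kronecker (A * C) (B * D))" "j < dim_col (kronecker (A * C) (B * D))"
  hence ij: "i < a * c" "j < e * f" by (simp_all add: kronecker_def dims)
  hence bounds: "i div c < a" "i mod c < c" "j div f < e" "j mod f < f"
    by (simp_all add: less_mult_imp_div_less less_mult_imp_mod_less)
  let ?g = "\<lambda>s. A $$ (i div c, s div d) * B $$ (i mod c, s mod d)
                * (C $$ (s div d, j div f) * D $$ (s mod d, j mod f))"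
  have "(kronecker A B * kronecker C D) $$ (i, j) = (\<Sum>s<b * d. ?g s)"
    using ij by (simp add: scalar_prod_def kronecker_def dims lessThan_atLeast0)
  also have "\<dots> = (\<Sum>p<b. \<Sum>s = p * d..<p * d + d. ?g s)"
    by (rule sum.nat_group[symmetric])
  also have "\<dots> = (\<Sum>p<b. \<Sum>q<d. ?g (p * d + q))"
    by (simp add: sum.shift_bounds_nat_ivl[of _ 0 _ d, simplified] atLeast0LessThan
        sum.atLeastLessThan_shift_0[of _ "_ * d"] add.commute)
  also have "\<dots> = (\<Sum>p<b. \<Sum>q<d. (A $$ (i div c, p) * C $$ (p, j div f))
                               * (B $$ (i mod c, q) * D $$ (q, j mod f)))"
    by (intro sum.cong) auto
  also have "\<dots> = (\<Sum>p<b. A $$ (i div c, p) * C $$ (p, j div f))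
                * (\<Sum>q<d. B $$ (i mod c, q) * D $$ (q, j mod f))"
    by (simp add: sum_product)
  also have "\<dots> = kronecker (A * C) (B * D) $$ (i, j)"
    using ij bounds by (simp add: scalar_prod_def kronecker_def dims lessThan_atLeast0)
  finally show "(kronecker A B * kronecker C D) $$ (i, j) = kronecker (A * C) (B * D) $$ (i, j)" .
qed (use assms in \<open>auto simp: kronecker_def\<close>)

lemma kronecker_smult:
  "kronecker (s \<cdot>\<^sub>m A) (t \<cdot>\<^sub>m B) = (s * t) \<cdot>\<^sub>m kronecker A B"
proof (rule eq_matI)
  fix i j
  assume "i < dim_row ((s * t) \<cdot>\<^sub>m kronecker A B)" "j < dim_col ((s * t) \<cdot>\<^sub>m kronecker A B)"
  hence ij: "i < dim_row A * dim_row B" "j < dim_col A * dim_col B"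
    by (simp_all add: kronecker_def)
  hence "i div dim_row B < dim_row A" "i mod dim_row B < dim_row B"
    "j div dim_col B < dim_col A" "j mod dim_col B < dim_col B"
    by (simp_all add: less_mult_imp_div_less less_mult_imp_mod_less)
  with ij show "kronecker (s \<cdot>\<^sub>m A) (t \<cdot>\<^sub>m B) $$ (i, j) = ((s * t) \<cdot>\<^sub>m kronecker A B) $$ (i, j)"
    by (simp add: kronecker_def)
qed (simp_all add: kronecker_def)

lemma kronecker_one: "kronecker (1\<^sub>m k) (1\<^sub>m l) = 1\<^sub>m (k * l)"
proof (rule eq_matI)
  fix i j assume "i < dim_row (1\<^sub>m (k * l) :: complex mat)" "j < dim_col (1\<^sub>m (k * l) :: complex mat)"
  hence ij: "i < k * l" "j < k * l" by simp_all
  hence "i div l < k" "i mod l < l" "j div l < k" "j mod l < l"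
    by (simp_all add: less_mult_imp_div_less less_mult_imp_mod_less)
  moreover have "i = j \<longleftrightarrow> i div l = j div l \<and> i mod l = j mod l"
    by (metis div_mult_mod_eq)
  ultimately show "kronecker (1\<^sub>m k) (1\<^sub>m l) $$ (i, j) = (1\<^sub>m (k * l) :: complex mat) $$ (i, j)"
    using ij by (auto simp: kronecker_def)
qed (simp_all add: kronecker_def)

section \<open>Tensor products of Weyl matrices\<close>

text \<open>
  Indexing by functions, with a shift for the tail, makes the index family an element of
  \<open>hyperbolic_sum_group ls\<close> as it stands; values beyond the length of \<open>ls\<close> are ignored.
\<close>

fun weyl_tensor :: "nat list \<Rightarrow> (nat \<Rightarrow> int \<times> int) \<Rightarrow> complex mat" where
  "weyl_tensor [] x = 1\<^sub>m 1"
| "weyl_tensor (l # ls) x = kronecker (weyl l (x 0)) (weyl_tensor ls (\<lambda>i. x (Suc i)))"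

definition weyl_cocycle :: "nat list \<Rightarrow> (nat \<Rightarrow> int \<times> int) \<Rightarrow> (nat \<Rightarrow> int \<times> int) \<Rightarrow> complex" where
  "weyl_cocycle ls x y = (\<Prod>i<length ls. root_of_unity (ls ! i) powi (- (snd (x i) * fst (y i))))"

lemma weyl_tensor_carrier [simp]:
  "weyl_tensor ls x \<in> carrier_mat (prod_list ls) (prod_list ls)"
  by (induction ls arbitrary: x) (auto intro!: kronecker_carrier)

lemma weyl_tensor_cong:
  assumes "\<forall>l\<in>set ls. l > 0"
    and "\<And>i. i < length ls \<Longrightarrow> fst (x i) mod int (ls ! i) = fst (y i) mod int (ls ! i)"
    and "\<And>i. i < length ls \<Longrightarrow> snd (x i) mod int (ls ! i) = snd (y i) mod int (ls ! i)"
  shows "weyl_tensor ls x = weyl_tensor ls y"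
  using assms
proof (induction ls arbitrary: x y)
  case (Cons l ls)
  have "weyl l (x 0) = weyl l (y 0)"
    using Cons.prems(1) Cons.prems(2,3)[of 0] by (intro weyl_cong) auto
  moreover have "weyl_tensor ls (\<lambda>i. x (Suc i)) = weyl_tensor ls (\<lambda>i. y (Suc i))"
    using Cons.prems(1) Cons.prems(2,3)[of "Suc _"] by (intro Cons.IH) auto
  ultimately show ?case by simp
qed simp

lemma weyl_tensor_zero: "weyl_tensor ls (\<lambda>_. 0) = 1\<^sub>m (prod_list ls)"
  by (induction ls) (simp_all add: weyl_zero kronecker_one)

lemma weyl_tensor_mult:
  assumes "\<forall>l\<in>set ls. l > 0"
  shows "weyl_tensor ls x * weyl_tensor ls y
       = weyl_cocycle ls x y \<cdot>\<^sub>m weyl_tensor ls (\<lambda>i. x i + y i)"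
  using assms
proof (induction ls arbitrary: x y)
  case Nil
  show ?case by (simp add: weyl_cocycle_def one_smult_mat)
next
  case (Cons l ls)
  have "weyl_tensor (l # ls) x * weyl_tensor (l # ls) y
      = kronecker (weyl l (x 0) * weyl l (y 0))
          (weyl_tensor ls (\<lambda>i. x (Suc i)) * weyl_tensor ls (\<lambda>i. y (Suc i)))"
    by (simp add: kronecker_mult[OF weyl_carrier weyl_tensor_carrier weyl_carrier weyl_tensor_carrier])
  also have "\<dots> = (root_of_unity l powi (- (snd (x 0) * fst (y 0)))
        * weyl_cocycle ls (\<lambda>i. x (Suc i)) (\<lambda>i. y (Suc i)))
      \<cdot>\<^sub>m weyl_tensor (l # ls) (\<lambda>i. x i + y i)"
    using Cons.prems by (simp add: weyl_mult Cons.IH kronecker_smult)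
  also have "root_of_unity l powi (- (snd (x 0) * fst (y 0)))
        * weyl_cocycle ls (\<lambda>i. x (Suc i)) (\<lambda>i. y (Suc i)) = weyl_cocycle (l # ls) x y"
    unfolding weyl_cocycle_def by (simp only: length_Cons prod.lessThan_Suc_shift nth_Cons_0 nth_Cons_Suc)
  finally show ?case .
qed

lemma weyl_cocycle_nonzero [simp]: "weyl_cocycle ls x y \<noteq> 0"
  by (simp add: weyl_cocycle_def)

lemma hyperbolic_sum_pairing_eq:
  "hyperbolic_sum_pairing ls x y = (\<Prod>i<length ls.
     root_of_unity (ls ! i) powi (fst (x i) * snd (y i) - snd (x i) * fst (y i)))"
  by (simp add: hyperbolic_sum_pairing_def hyperbolic_pairing_def split_def)

text \<open>The commutator pairing comes from this antisymmetrization of the cocycle.\<close>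

lemma weyl_cocycle_swap:
  "weyl_cocycle ls x y = hyperbolic_sum_pairing ls x y * weyl_cocycle ls y x"
  unfolding weyl_cocycle_def hyperbolic_sum_pairing_eq prod.distrib[symmetric]
  by (intro prod.cong) (simp_all flip: power_int_add add: algebra_simps)

lemma weyl_tensor_commute:
  assumes "\<forall>l\<in>set ls. l > 0"
  shows "weyl_tensor ls x * weyl_tensor ls y
       = hyperbolic_sum_pairing ls x y \<cdot>\<^sub>m (weyl_tensor ls y * weyl_tensor ls x)"
  by (simp add: weyl_tensor_mult[OF assms] weyl_cocycle_swap[of ls x y] add.commute smult_smult_mat)

section \<open>Invertible matrices modulo scalars\<close>

lemma carrier_GL: "carrier (GL n) = {A \<in> carrier_mat n n. \<exists>B \<in> carrier_mat n n. B * A = 1\<^sub>m n \<and> A * B = 1\<^sub>m n}"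
  by (simp add: GL_def units_of_carrier Units_def ring_mat_simps)

lemma GL_simps [simp]: "monoid.mult (GL n) = (*)" "one (GL n) = 1\<^sub>m n"
  by (simp_all add: GL_def units_of_mult units_of_one ring_mat_simps)

lemma group_GL: "group (GL n)"
proof -
  interpret semiring "ring_mat TYPE(complex) n ()" by (rule semiring_mat)
  show ?thesis unfolding GL_def by (rule units_group)
qed

lemma GL_carrier_mat: "A \<in> carrier (GL n) \<Longrightarrow> A \<in> carrier_mat n n"
  by (simp add: carrier_GL)

lemma GL_I:
  assumes "A \<in> carrier_mat n n" "B \<in> carrier_mat n n"
    and "A * B = c \<cdot>\<^sub>m 1\<^sub>m n" "B * A = c \<cdot>\<^sub>m 1\<^sub>m n" "c \<noteq> 0"
  shows "A \<in> carrier (GL n)"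
proof -
  have "(inverse c \<cdot>\<^sub>m B) * A = 1\<^sub>m n" "A * (inverse c \<cdot>\<^sub>m B) = 1\<^sub>m n"
    using assms by (simp_all add: mult_smult_distrib[OF assms(1,2)]
        mult_smult_assoc_mat[OF assms(2,1)] smult_smult_mat one_smult_mat)
  thus ?thesis using assms(1,2) by (auto simp: carrier_GL intro!: bexI[of _ "inverse c \<cdot>\<^sub>m B"])
qed

lemma scalar_in_GL: "c \<noteq> 0 \<Longrightarrow> c \<cdot>\<^sub>m 1\<^sub>m n \<in> carrier (GL n)"
  by (rule GL_I[where B = "1\<^sub>m n" and c = c]) (simp_all add: smult_one_mult mult_smult_one)

lemma smult_in_GL: "A \<in> carrier (GL n) \<Longrightarrow> c \<noteq> 0 \<Longrightarrow> c \<cdot>\<^sub>m A \<in> carrier (GL n)"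
  using monoid.m_closed[OF group.is_monoid[OF group_GL] scalar_in_GL, of c A n]
  by (simp add: smult_one_mult GL_carrier_mat)

lemma normal_scalar_mats: "scalar_mats n \<lhd> GL n"
proof -
  interpret group "GL n" by (rule group_GL)
  have "subgroup (scalar_mats n) (GL n)"
  proof (rule subgroupI)
    show "scalar_mats n \<subseteq> carrier (GL n)" by (auto simp: scalar_mats_def scalar_in_GL)
    show "scalar_mats n \<noteq> {}" by (auto simp: scalar_mats_def intro: exI[of _ 1])
  next
    fix A assume "A \<in> scalar_mats n"
    then obtain c where c: "c \<noteq> 0" "A = c \<cdot>\<^sub>m 1\<^sub>m n" by (auto simp: scalar_mats_def)
    have "inv\<^bsub>GL n\<^esub> A = inverse c \<cdot>\<^sub>m 1\<^sub>m n"
      using c by (intro inv_equality scalar_in_GL) (simp_all add: smult_one_mult scalar_in_GL smult_smult_mat one_smult_mat)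
    thus "inv\<^bsub>GL n\<^esub> A \<in> scalar_mats n" using c by (auto simp: scalar_mats_def intro!: exI[of _ "inverse c"])
  next
    fix A B assume "A \<in> scalar_mats n" "B \<in> scalar_mats n"
    then obtain c d where "c \<noteq> 0" "A = c \<cdot>\<^sub>m 1\<^sub>m n" "d \<noteq> 0" "B = d \<cdot>\<^sub>m 1\<^sub>m n"
      by (auto simp: scalar_mats_def)
    thus "A \<otimes>\<^bsub>GL n\<^esub> B \<in> scalar_mats n"
      by (auto simp: scalar_mats_def smult_one_mult smult_smult_mat intro!: exI[of _ "c * d"])
  qed
  moreover have "x \<otimes>\<^bsub>GL n\<^esub> h \<otimes>\<^bsub>GL n\<^esub> inv\<^bsub>GL n\<^esub> x \<in> scalar_mats n"
    if "x \<in> carrier (GL n)" "h \<in> scalar_mats n" for x h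
  proof -
    obtain c where c: "c \<noteq> 0" "h = c \<cdot>\<^sub>m 1\<^sub>m n"
      using \<open>h \<in> scalar_mats n\<close> by (auto simp: scalar_mats_def)
    have "x \<otimes>\<^bsub>GL n\<^esub> h = h \<otimes>\<^bsub>GL n\<^esub> x"
      using that c by (simp add: smult_one_mult mult_smult_one GL_carrier_mat)
    hence "x \<otimes>\<^bsub>GL n\<^esub> h \<otimes>\<^bsub>GL n\<^esub> inv\<^bsub>GL n\<^esub> x = h \<otimes>\<^bsub>GL n\<^esub> x \<otimes>\<^bsub>GL n\<^esub> inv\<^bsub>GL n\<^esub> x"
      by (simp only:)
    also have "\<dots> = h" using that c by (subst m_assoc) (simp_all add: scalar_in_GL del: GL_simps)
    finally show ?thesis using that by simp
  qed
  ultimately show ?thesis by (simp add: normal_inv_iff)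
qed

lemma Ad_eq: "A \<in> carrier (GL n) \<Longrightarrow> Ad n A = {c \<cdot>\<^sub>m A | c. c \<noteq> 0}"
  by (force simp: Ad_def r_coset_def scalar_mats_def smult_one_mult GL_carrier_mat)

lemma Ad_smult:
  assumes "A \<in> carrier (GL n)" "c \<noteq> 0"
  shows "Ad n (c \<cdot>\<^sub>m A) = Ad n A"
proof -
  have "\<exists>e. s \<cdot>\<^sub>m A = e \<cdot>\<^sub>m (c \<cdot>\<^sub>m A) \<and> e \<noteq> 0" if "s \<noteq> 0" for s
    using that assms(2) by (intro exI[of _ "s / c"]) (simp add: smult_smult_mat)
  moreover have "\<exists>e. s \<cdot>\<^sub>m (c \<cdot>\<^sub>m A) = e \<cdot>\<^sub>m A \<and> e \<noteq> 0" if "s \<noteq> 0" for s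
    using that assms(2) by (intro exI[of _ "s * c"]) (simp add: smult_smult_mat)
  ultimately show ?thesis using assms by (auto simp: Ad_eq smult_in_GL)
qed

lemma Ad_mult:
  assumes "A \<in> carrier (GL n)" "B \<in> carrier (GL n)"
  shows "Ad n A \<otimes>\<^bsub>PGL n\<^esub> Ad n B = Ad n (A * B)"
  using normal.rcos_sum[OF normal_scalar_mats assms] by (simp add: Ad_def PGL_def)

lemma Ad_one: "Ad n (1\<^sub>m n) = \<one>\<^bsub>PGL n\<^esub>"
proof -
  have "1\<^sub>m n \<in> carrier (GL n)" using scalar_in_GL[of 1 n] by (simp add: one_smult_mat)
  thus ?thesis by (simp add: Ad_eq PGL_def FactGroup_def scalar_mats_def)
qed

lemma commutator_GL:
  assumes "A \<in> carrier (GL n)" "B \<in> carrier (GL n)" "A * B = c \<cdot>\<^sub>m (B * A)"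
  shows "A \<otimes>\<^bsub>GL n\<^esub> B \<otimes>\<^bsub>GL n\<^esub> inv\<^bsub>GL n\<^esub> A \<otimes>\<^bsub>GL n\<^esub> inv\<^bsub>GL n\<^esub> B = c \<cdot>\<^sub>m 1\<^sub>m n"
proof -
  interpret group "GL n" by (rule group_GL)
  define A' B' where "A' = inv\<^bsub>GL n\<^esub> A" and "B' = inv\<^bsub>GL n\<^esub> B"
  have carr: "A \<in> carrier_mat n n" "B \<in> carrier_mat n n" "A' \<in> carrier_mat n n" "B' \<in> carrier_mat n n"
    using assms by (auto simp: A'_def B'_def intro!: GL_carrier_mat)
  have inv: "A * A' = 1\<^sub>m n" "B * B' = 1\<^sub>m n"
    using r_inv[OF assms(1)] r_inv[OF assms(2)] by (simp_all add: A'_def B'_def)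
  have "A * B * A' * B' = (c \<cdot>\<^sub>m (B * A)) * A' * B'" by (simp only: assms(3))
  also have "\<dots> = c \<cdot>\<^sub>m (B * A * A' * B')"
    using carr by (simp add: mult_smult_assoc_mat[of _ n n _ n])
  also have "B * A * A' = B"
    using carr inv by (simp add: assoc_mult_mat[of _ n n _ n _ n])
  also have "B * B' = 1\<^sub>m n" by (rule inv)
  finally show ?thesis by (simp add: A'_def B'_def)
qed

text \<open>
  One pair of preimages determines the pairing: rescaling \<open>A\<close> and \<open>B\<close> scales both sides
  of \<open>A B = c B A\<close> alike. Comparing the entry \<open>(0, 0)\<close>, which exists as \<open>n \<ge> 1\<close>, shows
  that \<open>c\<close> is the only such scalar.
\<close>

lemma pairing_Ad:
  assumes "n \<ge> 1" and A: "A \<in> carrier (GL n)" and B: "B \<in> carrier (GL n)"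
    and comm: "A * B = c \<cdot>\<^sub>m (B * A)"
  shows "pairing n (Ad n A) (Ad n B) = c"
  unfolding pairing_def
proof (rule the_equality)
  show "\<forall>X\<in>Ad n A. \<forall>Y\<in>Ad n B.
      X \<otimes>\<^bsub>GL n\<^esub> Y \<otimes>\<^bsub>GL n\<^esub> inv\<^bsub>GL n\<^esub> X \<otimes>\<^bsub>GL n\<^esub> inv\<^bsub>GL n\<^esub> Y = c \<cdot>\<^sub>m 1\<^sub>m n"
  proof (intro ballI)
    fix X Y assume "X \<in> Ad n A" "Y \<in> Ad n B"
    then obtain s t where st: "X = s \<cdot>\<^sub>m A" "s \<noteq> 0" "Y = t \<cdot>\<^sub>m B" "t \<noteq> 0"
      using A B by (auto simp: Ad_eq)
    have "X * Y = c \<cdot>\<^sub>m (Y * X)"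
      using A B comm by (simp add: st mult_smult_assoc_mat[of _ n n _ n]
          mult_smult_distrib[of _ n n _ n] GL_carrier_mat smult_smult_mat mult_ac)
    thus "X \<otimes>\<^bsub>GL n\<^esub> Y \<otimes>\<^bsub>GL n\<^esub> inv\<^bsub>GL n\<^esub> X \<otimes>\<^bsub>GL n\<^esub> inv\<^bsub>GL n\<^esub> Y = c \<cdot>\<^sub>m 1\<^sub>m n"
      using A B st by (intro commutator_GL smult_in_GL) (auto simp: smult_in_GL)
  qed
next
  fix d
  assume d: "\<forall>X\<in>Ad n A. \<forall>Y\<in>Ad n B.
      X \<otimes>\<^bsub>GL n\<^esub> Y \<otimes>\<^bsub>GL n\<^esub> inv\<^bsub>GL n\<^esub> X \<otimes>\<^bsub>GL n\<^esub> inv\<^bsub>GL n\<^esub> Y = d \<cdot>\<^sub>m 1\<^sub>m n"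
  have "A \<in> Ad n A" "B \<in> Ad n B"
    using A B by (auto simp: Ad_eq one_smult_mat intro!: exI[of _ 1])
  hence "d \<cdot>\<^sub>m 1\<^sub>m n = c \<cdot>\<^sub>m (1\<^sub>m n :: complex mat)"
    using d commutator_GL[OF A B comm] by metis
  hence "(d \<cdot>\<^sub>m 1\<^sub>m n) $$ (0, 0) = (c \<cdot>\<^sub>m (1\<^sub>m n :: complex mat)) $$ (0, 0)" by simp
  thus "d = c" using \<open>n \<ge> 1\<close> by simp
qed


lemma Ad_eqD:
  assumes "A \<in> carrier (GL n)" "B \<in> carrier (GL n)" "Ad n A = Ad n B"
  obtains c where "c \<noteq> 0" "A = c \<cdot>\<^sub>m B"
proof -
  have "A \<in> Ad n A" using assms(1) by (auto simp: Ad_eq one_smult_mat intro!: exI[of _ 1])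
  thus ?thesis using assms that by (auto simp: Ad_eq)
qed

section \<open>Pauli groups as classes of Weyl matrices\<close>

lemma weyl_tensor_in_GL:
  assumes "\<forall>l\<in>set ls. l > 0"
  shows "weyl_tensor ls x \<in> carrier (GL (prod_list ls))"
proof (rule GL_I)
  let ?y = "\<lambda>i. - x i"
  show "weyl_tensor ls x * weyl_tensor ls ?y = weyl_cocycle ls x ?y \<cdot>\<^sub>m 1\<^sub>m (prod_list ls)"
    by (simp add: weyl_tensor_mult[OF assms] weyl_tensor_zero)
  show "weyl_tensor ls ?y * weyl_tensor ls x = weyl_cocycle ls x ?y \<cdot>\<^sub>m 1\<^sub>m (prod_list ls)"
    by (simp add: weyl_tensor_mult[OF assms] weyl_tensor_zero weyl_cocycle_def)
qed simp_all

lemma weyl_inverse: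
  assumes "l > 0"
  obtains c where "c \<noteq> 0" "weyl l (- a) * weyl l a = c \<cdot>\<^sub>m 1\<^sub>m l" "weyl l a * weyl l (- a) = c \<cdot>\<^sub>m 1\<^sub>m l"
  using that[of "root_of_unity l powi (snd a * fst a)"] by (simp add: weyl_mult[OF assms] weyl_zero)

lemma weyl_in_GL: "l > 0 \<Longrightarrow> weyl l a \<in> carrier (GL l)"
  using GL_I[OF weyl_carrier weyl_carrier] weyl_inverse by metis

lemma inv_weyl:
  assumes "l > 0"
  obtains c where "c \<noteq> 0" "inv\<^bsub>GL l\<^esub> (weyl l a) = c \<cdot>\<^sub>m weyl l (- a)"
proof -
  obtain c where c: "c \<noteq> 0" "weyl l (- a) * weyl l a = c \<cdot>\<^sub>m 1\<^sub>m l"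
    using weyl_inverse[OF assms] by blast
  have "(inverse c \<cdot>\<^sub>m weyl l (- a)) * weyl l a = 1\<^sub>m l"
    using c by (simp add: mult_smult_assoc_mat[OF weyl_carrier weyl_carrier] smult_smult_mat one_smult_mat)
  hence "inv\<^bsub>GL l\<^esub> (weyl l a) = inverse c \<cdot>\<^sub>m weyl l (- a)"
    using assms c by (intro group.inv_equality[OF group_GL]) (simp_all add: weyl_in_GL smult_in_GL)
  thus ?thesis using that[of "inverse c"] c by simp
qed

text \<open>
  The nonzero multiples of Weyl matrices are closed under products and inverses, so they
  contain the group generated by \<open>weyl l (1, 0)\<close> and \<open>weyl l (0, 1)\<close>.
\<close>

lemma generate_P_Q_imp_weyl:
  assumes "l > 0" "A \<in> generate (GL l) {P_mat l, Q_mat l}"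
  shows "\<exists>c a. c \<noteq> 0 \<and> A = c \<cdot>\<^sub>m weyl l a"
  using assms(2)
proof induction
  case one
  have "\<one>\<^bsub>GL l\<^esub> = 1 \<cdot>\<^sub>m weyl l 0" by (simp add: weyl_zero one_smult_mat)
  thus ?case by (intro exI conjI) simp_all
next
  case (incl h)
  then obtain a where "h = weyl l a" by (metis insert_iff singletonD weyl_P weyl_Q)
  hence "h = 1 \<cdot>\<^sub>m weyl l a" by (simp add: one_smult_mat)
  thus ?case by (intro exI conjI) simp_all
next
  case (inv h)
  then obtain a where "h = weyl l a" by (metis insert_iff singletonD weyl_P weyl_Q)
  thus ?case using inv_weyl[OF assms(1), of a] by metis
next
  case (eng A B)
  then obtain c a d b where "c \<noteq> 0" "A = c \<cdot>\<^sub>m weyl l a" "d \<noteq> 0" "B = d \<cdot>\<^sub>m weyl l b" by auto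
  moreover define e where "e = d * c * root_of_unity l powi (- (snd a * fst b))"
  ultimately have "e \<noteq> 0" by simp
  have "A * B = e \<cdot>\<^sub>m weyl l (a + b)"
    unfolding e_def \<open>A = c \<cdot>\<^sub>m weyl l a\<close> \<open>B = d \<cdot>\<^sub>m weyl l b\<close>
    by (simp add: mult_smult_assoc_mat[of _ l l _ l] mult_smult_distrib[of _ l l _ l]
        weyl_mult[OF assms(1)] smult_smult_mat mult_ac)
  hence "A \<otimes>\<^bsub>GL l\<^esub> B = e \<cdot>\<^sub>m weyl l (a + b)" by simp
  with \<open>e \<noteq> 0\<close> show ?case by (intro exI conjI)
qed

text \<open>
  The cocycle is trivial on \<open>(i, 0)\<close>, \<open>(0, j)\<close> in this order, so \<open>weyl l (i, j)\<close> is exactly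
  \<open>P\<^sup>i Q\<^sup>j\<close>; by periodicity nonnegative exponents suffice.
\<close>

lemma weyl_in_generate:
  assumes "l > 0"
  shows "weyl l a \<in> generate (GL l) {P_mat l, Q_mat l}"
proof -
  let ?G = "generate (GL l) {P_mat l, Q_mat l}"
  have closed: "A * B \<in> ?G" if "A \<in> ?G" "B \<in> ?G" for A B
    using generate.eng[OF that] by simp
  have one: "1\<^sub>m l \<in> ?G" using generate.one[of "GL l"] by simp
  have P: "weyl l (int i, 0) \<in> ?G" for i
  proof (induction i)
    case (Suc i)
    have "weyl l (1, 0) * weyl l (int i, 0) = weyl l (int (Suc i), 0)"
      by (simp add: weyl_mult[OF assms] one_smult_mat)
    moreover have "weyl l (1, 0) \<in> ?G" by (auto simp: weyl_P intro: generate.incl)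
    ultimately show ?case using closed Suc by metis
  qed (use one in \<open>simp add: weyl_zero flip: zero_prod_def\<close>)
  have Q: "weyl l (0, int j) \<in> ?G" for j
  proof (induction j)
    case (Suc j)
    have "weyl l (0, 1) * weyl l (0, int j) = weyl l (0, int (Suc j))"
      by (simp add: weyl_mult[OF assms] one_smult_mat)
    moreover have "weyl l (0, 1) \<in> ?G" by (auto simp: weyl_Q intro: generate.incl)
    ultimately show ?case using closed Suc by metis
  qed (use one in \<open>simp add: weyl_zero flip: zero_prod_def\<close>)
  define i j where "i = nat (fst a mod int l)" and "j = nat (snd a mod int l)"
  have "weyl l a = weyl l (int i, int j)"
    using assms by (intro weyl_cong) (simp_all add: i_def j_def)
  also have "\<dots> = weyl l (int i, 0) * weyl l (0, int j)"
    by (simp add: weyl_mult[OF assms] one_smult_mat)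
  finally show ?thesis using closed P Q by metis
qed

lemma Ad_in_Pauli_iff:
  assumes "l > 0" "A \<in> carrier (GL l)"
  shows "Ad l A \<in> Pauli l \<longleftrightarrow> (\<exists>c a. c \<noteq> 0 \<and> A = c \<cdot>\<^sub>m weyl l a)"
proof
  assume "Ad l A \<in> Pauli l"
  then obtain B where "B \<in> generate (GL l) {P_mat l, Q_mat l}" "Ad l A = Ad l B"
    by (auto simp: Pauli_def)
  moreover from this obtain c a where "c \<noteq> 0" "B = c \<cdot>\<^sub>m weyl l a"
    using generate_P_Q_imp_weyl[OF assms(1)] by blast
  ultimately have "Ad l A = Ad l (weyl l a)"
    using assms by (simp add: Ad_smult weyl_in_GL)
  thus "\<exists>c a. c \<noteq> 0 \<and> A = c \<cdot>\<^sub>m weyl l a"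
    using Ad_eqD[OF assms(2) weyl_in_GL[OF assms(1)]] by metis
next
  assume "\<exists>c a. c \<noteq> 0 \<and> A = c \<cdot>\<^sub>m weyl l a"
  then obtain c a where "c \<noteq> 0" "A = c \<cdot>\<^sub>m weyl l a" by blast
  thus "Ad l A \<in> Pauli l"
    using assms weyl_in_generate[OF assms(1)] by (auto simp: Pauli_def Ad_smult weyl_in_GL)
qed

text \<open>
  The next two lemmas are the two inclusions between the product of Pauli groups and the
  classes of tensor products of Weyl matrices. The scalars of the single factors
  multiply to one scalar in front of the tensor product, which is lost in \<open>PGL\<close>.
\<close>

lemma kronecker_list_weyl:
  assumes "\<forall>l\<in>set ls. l > 0"
    and "list_all2 (\<lambda>A l. A \<in> carrier (GL l) \<and> Ad l A \<in> Pauli l) As ls"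
  shows "\<exists>c x. c \<noteq> 0 \<and> kronecker_list As = c \<cdot>\<^sub>m weyl_tensor ls x"
  using assms(2,1)
proof (induction rule: list_all2_induct)
  case Nil
  show ?case by (auto intro!: exI[of _ 1] simp: kronecker_list_def one_smult_mat)
next
  case (Cons A As l ls)
  then obtain c x where "c \<noteq> 0" "kronecker_list As = c \<cdot>\<^sub>m weyl_tensor ls x" by auto
  moreover obtain d a where "d \<noteq> 0" "A = d \<cdot>\<^sub>m weyl l a"
    using Cons Ad_in_Pauli_iff[of l A] by auto
  ultimately have "d * c \<noteq> 0" "kronecker_list (A # As) = (d * c) \<cdot>\<^sub>m weyl_tensor (l # ls) (case_nat a x)"
    by (simp_all add: kronecker_list_def kronecker_smult)
  thus ?case by blast
qed

lemma weyl_tensor_kronecker_list: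
  assumes "\<forall>l\<in>set ls. l > 0"
  shows "\<exists>As. list_all2 (\<lambda>A l. A \<in> carrier (GL l) \<and> Ad l A \<in> Pauli l) As ls
            \<and> kronecker_list As = weyl_tensor ls x"
  using assms
proof (induction ls arbitrary: x)
  case Nil
  show ?case by (auto simp: kronecker_list_def)
next
  case (Cons l ls)
  then obtain As where As: "list_all2 (\<lambda>A l. A \<in> carrier (GL l) \<and> Ad l A \<in> Pauli l) As ls"
    "kronecker_list As = weyl_tensor ls (\<lambda>i. x (Suc i))" by force
  have "weyl l (x 0) \<in> carrier (GL l)" "Ad l (weyl l (x 0)) \<in> Pauli l"
    using Cons.prems weyl_in_generate[of l "x 0"] by (auto simp: Pauli_def weyl_in_GL)
  with As show ?case
    by (intro exI[of _ "weyl l (x 0) # As"]) (simp add: kronecker_list_def)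
qed

definition weyl_class :: "nat list \<Rightarrow> (nat \<Rightarrow> int \<times> int) \<Rightarrow> complex mat set" where
  "weyl_class ls x = Ad (prod_list ls) (weyl_tensor ls x)"

lemma Pauli_product_eq:
  assumes "\<forall>l\<in>set ls. l > 0"
  shows "Pauli_product ls = range (weyl_class ls)"
proof
  show "Pauli_product ls \<subseteq> range (weyl_class ls)"
  proof
    fix \<sigma> assume "\<sigma> \<in> Pauli_product ls"
    then obtain As where \<sigma>: "\<sigma> = Ad (prod_list ls) (kronecker_list As)"
      and As: "list_all2 (\<lambda>A l. A \<in> carrier (GL l) \<and> Ad l A \<in> Pauli l) As ls"
      unfolding Pauli_product_def by blast
    obtain c x where "c \<noteq> 0" "kronecker_list As = c \<cdot>\<^sub>m weyl_tensor ls x"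
      using kronecker_list_weyl[OF assms As] by blast
    hence "\<sigma> = weyl_class ls x"
      by (simp add: \<sigma> weyl_class_def Ad_smult weyl_tensor_in_GL[OF assms])
    thus "\<sigma> \<in> range (weyl_class ls)" by blast
  qed
  show "range (weyl_class ls) \<subseteq> Pauli_product ls"
  proof
    fix \<sigma> assume "\<sigma> \<in> range (weyl_class ls)"
    then obtain x where x: "\<sigma> = weyl_class ls x" by blast
    obtain As where As: "list_all2 (\<lambda>A l. A \<in> carrier (GL l) \<and> Ad l A \<in> Pauli l) As ls"
      and "kronecker_list As = weyl_tensor ls x"
      using weyl_tensor_kronecker_list[OF assms, of x] by blast
    hence "\<sigma> = Ad (prod_list ls) (kronecker_list As)" by (simp add: x weyl_class_def)
    with As show "\<sigma> \<in> Pauli_product ls"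
      unfolding Pauli_product_def by (intro CollectI exI conjI)
  qed
qed

section \<open>The hyperbolic pairing\<close>

lemma hyperbolic_sum_pairing_add_left:
  "hyperbolic_sum_pairing ls (\<lambda>i. x i + y i) z = hyperbolic_sum_pairing ls x z * hyperbolic_sum_pairing ls y z"
  unfolding hyperbolic_sum_pairing_eq prod.distrib[symmetric]
  by (intro prod.cong) (simp_all flip: power_int_add add: algebra_simps)

lemma hyperbolic_sum_pairing_swap:
  "hyperbolic_sum_pairing ls x y = inverse (hyperbolic_sum_pairing ls y x)"
  unfolding hyperbolic_sum_pairing_eq prod_inversef[symmetric] o_def
  by (intro prod.cong) (simp_all flip: power_int_minus add: mult.commute)

lemma hyperbolic_sum_pairing_self: "hyperbolic_sum_pairing ls x x = 1"
  by (simp add: hyperbolic_sum_pairing_eq mult.commute)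

lemma hyperbolic_sum_pairing_nonzero: "hyperbolic_sum_pairing ls x y \<noteq> 0"
  by (simp add: hyperbolic_sum_pairing_eq)

text \<open>
  Test against the families supported at \<open>i\<close> with value \<open>(0, 1)\<close> or \<open>(1, 0)\<close>: only
  the factor at \<open>i\<close> survives, and it is a power of a primitive root of unity whose
  exponent is a coordinate of \<open>x i\<close> up to sign.
\<close>

lemma hyperbolic_sum_pairing_nonsingular:
  assumes "\<forall>l\<in>set ls. l > 0" "\<And>y. hyperbolic_sum_pairing ls x y = 1" "i < length ls"
  shows "int (ls ! i) dvd fst (x i)" "int (ls ! i) dvd snd (x i)"
proof -
  have "root_of_unity (ls ! i) powi (fst (x i) * snd b - snd (x i) * fst b) = 1" for b
  proof -
    have "1 = hyperbolic_sum_pairing ls x (\<lambda>k. if k = i then b else 0)"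
      by (simp add: assms(2))
    also have "\<dots> = (\<Prod>k<length ls. if k = i
        then root_of_unity (ls ! k) powi (fst (x k) * snd b - snd (x k) * fst b) else 1)"
      unfolding hyperbolic_sum_pairing_eq by (intro prod.cong) auto
    also have "\<dots> = root_of_unity (ls ! i) powi (fst (x i) * snd b - snd (x i) * fst b)"
      using assms(3) by simp
    finally show ?thesis ..
  qed
  from this[of "(0, 1)"] this[of "(1, 0)"] assms(1,3)
  show "int (ls ! i) dvd fst (x i)" "int (ls ! i) dvd snd (x i)"
    by (simp_all add: root_of_unity_powi_eq_1_iff)
qed

section \<open>The isometry\<close>

text \<open>
  All pairings of classes are evaluated through this lemma: the symplectic identities and
  nonsingularity in \<open>PGL\<close> become statements on integer families.
\<close>

lemma pairing_weyl_class:
  assumes "\<forall>l\<in>set ls. l > 0"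
  shows "pairing (prod_list ls) (weyl_class ls x) (weyl_class ls y) = hyperbolic_sum_pairing ls x y"
proof -
  have "prod_list ls \<noteq> 0" using assms by (auto simp: prod_list_zero_iff)
  thus ?thesis unfolding weyl_class_def
    by (intro pairing_Ad weyl_tensor_in_GL weyl_tensor_commute assms) simp
qed

lemma weyl_class_mult:
  assumes "\<forall>l\<in>set ls. l > 0"
  shows "weyl_class ls x \<otimes>\<^bsub>PGL (prod_list ls)\<^esub> weyl_class ls y = weyl_class ls (\<lambda>i. x i + y i)"
  by (simp add: weyl_class_def Ad_mult Ad_smult weyl_tensor_in_GL weyl_tensor_mult assms)

lemma weyl_class_cong:
  assumes "\<forall>l\<in>set ls. l > 0"
    and "\<And>i. i < length ls \<Longrightarrow> fst (x i) mod int (ls ! i) = fst (y i) mod int (ls ! i)"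
    and "\<And>i. i < length ls \<Longrightarrow> snd (x i) mod int (ls ! i) = snd (y i) mod int (ls ! i)"
  shows "weyl_class ls x = weyl_class ls y"
  unfolding weyl_class_def using weyl_tensor_cong[OF assms] by simp

lemma weyl_class_zero: "weyl_class ls (\<lambda>_. 0) = \<one>\<^bsub>PGL (prod_list ls)\<^esub>"
  by (simp add: weyl_class_def weyl_tensor_zero Ad_one)

lemma carrier_hyperbolic_sum_group:
  assumes "\<forall>l\<in>set ls. l > 0"
  shows "carrier (hyperbolic_sum_group ls)
    = (\<Pi>\<^sub>E i\<in>{..<length ls}. {0..<int (ls ! i)} \<times> {0..<int (ls ! i)})"
  unfolding hyperbolic_sum_group_def carrier_product_group
  using assms by (intro PiE_cong) (auto simp: hyperbolic_group_def carrier_integer_mod_group)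

lemma mult_hyperbolic_sum_group:
  "x \<otimes>\<^bsub>hyperbolic_sum_group ls\<^esub> y = (\<lambda>i\<in>{..<length ls}.
     ((fst (x i) + fst (y i)) mod int (ls ! i), (snd (x i) + snd (y i)) mod int (ls ! i)))"
  by (simp add: hyperbolic_sum_group_def hyperbolic_group_def DirProd_def split_def)

lemma group_hyperbolic_sum_group: "group (hyperbolic_sum_group ls)"
  by (simp add: hyperbolic_sum_group_def hyperbolic_group_def DirProd_group)

lemma one_hyperbolic_sum_group:
  "\<one>\<^bsub>hyperbolic_sum_group ls\<^esub> = (\<lambda>i\<in>{..<length ls}. 0)"
  by (simp add: hyperbolic_sum_group_def hyperbolic_group_def zero_prod_def)

lemma weyl_class_image:
  assumes "\<forall>l\<in>set ls. l > 0"
  shows "weyl_class ls ` carrier (hyperbolic_sum_group ls) = range (weyl_class ls)"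
proof (intro subset_antisym subsetI)
  fix \<sigma> assume "\<sigma> \<in> range (weyl_class ls)"
  then obtain x where x: "\<sigma> = weyl_class ls x" by blast
  define y where "y = (\<lambda>i\<in>{..<length ls}. (fst (x i) mod int (ls ! i), snd (x i) mod int (ls ! i)))"
  have "\<sigma> = weyl_class ls y"
    unfolding x by (rule weyl_class_cong[OF assms]) (simp_all add: y_def)
  moreover have "y \<in> carrier (hyperbolic_sum_group ls)"
    using assms by (auto simp: y_def carrier_hyperbolic_sum_group[OF assms])
  ultimately show "\<sigma> \<in> weyl_class ls ` carrier (hyperbolic_sum_group ls)" by blast
qed blast

text \<open>
  Injectivity comes for free from the pairing: if \<open>x\<close> and \<open>0\<close> have the same class, then \<open>x\<close>
  pairs like \<open>0\<close> with everything, so it vanishes modulo the entries of \<open>ls\<close>, hence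
  vanishes as a family of residues.
\<close>

lemma weyl_class_iso:
  assumes pos: "\<forall>l\<in>set ls. l > 0"
    and "group ((PGL (prod_list ls))\<lparr>carrier := range (weyl_class ls)\<rparr>)"
  shows "weyl_class ls \<in> iso (hyperbolic_sum_group ls)
           ((PGL (prod_list ls))\<lparr>carrier := range (weyl_class ls)\<rparr>)"
    (is "_ \<in> iso ?H ?K")
proof -
  have hom: "weyl_class ls \<in> hom ?H ?K"
  proof (rule homI)
    fix x y
    have "weyl_class ls (\<lambda>i. x i + y i) = weyl_class ls (x \<otimes>\<^bsub>?H\<^esub> y)"
      by (rule weyl_class_cong[OF pos]) (simp_all add: mult_hyperbolic_sum_group)
    thus "weyl_class ls (x \<otimes>\<^bsub>?H\<^esub> y) = weyl_class ls x \<otimes>\<^bsub>?K\<^esub> weyl_class ls y"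
      by (simp add: weyl_class_mult[OF pos])
  qed simp
  interpret group_hom ?H ?K "weyl_class ls"
    using hom assms(2) group_hyperbolic_sum_group by (simp add: group_hom_def group_hom_axioms_def)
  have "x = \<one>\<^bsub>?H\<^esub>" if x: "x \<in> carrier ?H" "weyl_class ls x = \<one>\<^bsub>?K\<^esub>" for x
  proof -
    have "hyperbolic_sum_pairing ls x y = 1" for y
    proof -
      have "weyl_class ls x = weyl_class ls (\<lambda>_. 0)" using x(2) by (simp add: weyl_class_zero)
      hence "hyperbolic_sum_pairing ls x y = hyperbolic_sum_pairing ls (\<lambda>_. 0) y"
        by (metis pairing_weyl_class[OF pos])
      thus ?thesis by (simp add: hyperbolic_sum_pairing_eq)
    qed
    note dvd = hyperbolic_sum_pairing_nonsingular[OF pos this]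
    have xi: "fst (x i) \<in> {0..<int (ls ! i)}" "snd (x i) \<in> {0..<int (ls ! i)}" if "i < length ls" for i
      using x(1) that by (auto simp: carrier_hyperbolic_sum_group[OF pos] PiE_iff mem_Times_iff)
    have residue: "a = 0" if "int l dvd a" "a \<in> {0..<int l}" for a l
      using that zdvd_not_zless[of a "int l"] by force
    have "x i = 0" if "i < length ls" for i
      using residue[OF dvd(1) xi(1)] residue[OF dvd(2) xi(2)] that by (simp add: prod_eq_iff)
    moreover have "x \<in> extensional {..<length ls}"
      using x(1) by (simp add: carrier_hyperbolic_sum_group[OF pos] PiE_iff)
    ultimately show ?thesis
      by (auto simp: one_hyperbolic_sum_group extensional_def fun_eq_iff)
  qed
  moreover have "carrier ?K \<subseteq> weyl_class ls ` carrier ?H"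
    by (simp add: weyl_class_image[OF pos])
  ultimately show ?thesis unfolding iso_iff by blast
qed

theorem proposition5p5:
  fixes n :: nat and K :: "complex mat set set" and ls :: "nat list"
  assumes "n \<ge> 1"
    and "maximal_diagonalizable_subgroup n K"
    and "n = prod_list ls"
    and "\<And>i. Suc i < length ls \<Longrightarrow> ls ! Suc i dvd ls ! i"
    and "K = Pauli_product ls"
  shows "nonsingular_pairing ((PGL n)\<lparr>carrier := K\<rparr>) (pairing n) \<and>
         symplectic_abelian_group ((PGL n)\<lparr>carrier := K\<rparr>) (pairing n) \<and>
         isometric ((PGL n)\<lparr>carrier := K\<rparr>) (pairing n)
           (hyperbolic_sum_group ls) (hyperbolic_sum_pairing ls)"
proof -
  let ?G = "(PGL n)\<lparr>carrier := K\<rparr>" and ?H = "hyperbolic_sum_group ls"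
  have pos: "\<forall>l\<in>set ls. l > 0"
    using assms(1,3) by (metis One_nat_def gr0I not_one_le_zero prod_list_zero_iff)
  have K: "K = range (weyl_class ls)"
    using assms(5) Pauli_product_eq[OF pos] by simp
  have G: "comm_group ?G"
    using assms(2) by (simp add: maximal_diagonalizable_subgroup_def diagonalizable_subgroup_def)
  note pair = pairing_weyl_class[OF pos, folded assms(3)]
  note mult = weyl_class_mult[OF pos, folded assms(3)]
  have "nonsingular_pairing ?G (pairing n)"
    unfolding nonsingular_pairing_def
  proof (intro ballI impI)
    fix \<sigma> assume "\<sigma> \<in> carrier ?G" and orth: "\<forall>\<tau>\<in>carrier ?G. pairing n \<sigma> \<tau> = 1"
    then obtain x where x: "\<sigma> = weyl_class ls x" by (auto simp: K)
    have "hyperbolic_sum_pairing ls x y = 1" for y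
      using orth by (simp add: K x pair)
    note dvd = hyperbolic_sum_pairing_nonsingular[OF pos this]
    have "\<sigma> = weyl_class ls (\<lambda>_. 0)"
      unfolding x by (rule weyl_class_cong[OF pos]) (simp_all add: dvd)
    thus "\<sigma> = \<one>\<^bsub>?G\<^esub>" by (simp add: weyl_class_zero assms(3))
  qed
  moreover have "symplectic_abelian_group ?G (pairing n)"
  proof -
    have left: "pairing n (weyl_class ls x \<otimes>\<^bsub>PGL n\<^esub> weyl_class ls y) (weyl_class ls z)
        = pairing n (weyl_class ls x) (weyl_class ls z) * pairing n (weyl_class ls y) (weyl_class ls z)" for x y z
      by (simp add: mult pair hyperbolic_sum_pairing_add_left)
    have swap: "pairing n (weyl_class ls x) (weyl_class ls y)
        = inverse (pairing n (weyl_class ls y) (weyl_class ls x))" for x y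
      unfolding pair by (rule hyperbolic_sum_pairing_swap)
    have right: "pairing n (weyl_class ls x) (weyl_class ls y \<otimes>\<^bsub>PGL n\<^esub> weyl_class ls z)
        = pairing n (weyl_class ls x) (weyl_class ls y) * pairing n (weyl_class ls x) (weyl_class ls z)" for x y z
    proof -
      have "pairing n (weyl_class ls x) (weyl_class ls y \<otimes>\<^bsub>PGL n\<^esub> weyl_class ls z)
          = inverse (pairing n (weyl_class ls y \<otimes>\<^bsub>PGL n\<^esub> weyl_class ls z) (weyl_class ls x))"
        unfolding mult by (rule swap)
      thus ?thesis by (simp add: left swap[of x])
    qed
    have nonzero: "pairing n (weyl_class ls x) (weyl_class ls y) \<noteq> 0"
      and self: "pairing n (weyl_class ls x) (weyl_class ls x) = 1" for x y
      by (simp_all add: pair hyperbolic_sum_pairing_nonzero hyperbolic_sum_pairing_self)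
    have "carrier ?G = range (weyl_class ls)" "monoid.mult ?G = monoid.mult (PGL n)"
      by (simp_all add: K)
    thus ?thesis
      unfolding symplectic_abelian_group_def
      by (simp only: ball_simps ball_UNIV) (intro conjI allI G nonzero left right self swap)
  qed
  moreover have "isometric ?G (pairing n) ?H (hyperbolic_sum_pairing ls)"
    unfolding isometric_def
  proof (intro bexI ballI)
    have iso: "weyl_class ls \<in> iso ?H ?G"
      using weyl_class_iso[OF pos] comm_group.axioms(2)[OF G] by (simp add: K assms(3))
    let ?\<phi> = "inv_into (carrier ?H) (weyl_class ls)"
    show "?\<phi> \<in> iso ?G ?H"
      by (rule group.iso_set_sym[OF group_hyperbolic_sum_group iso])
    fix \<sigma> \<tau> assume "\<sigma> \<in> carrier ?G" "\<tau> \<in> carrier ?G"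
    hence "weyl_class ls (?\<phi> \<sigma>) = \<sigma>" "weyl_class ls (?\<phi> \<tau>) = \<tau>"
      by (simp_all add: K f_inv_into_f weyl_class_image[OF pos])
    thus "hyperbolic_sum_pairing ls (?\<phi> \<sigma>) (?\<phi> \<tau>) = pairing n \<sigma> \<tau>"
      by (metis pair)
  qed
  ultimately show ?thesis by blast
qed

end
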